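(* For every integer $n\ge 1$, \[ N(n)\le \frac{1}{6}n(n+1)p(n). \]
   Context: $p(n)$ is the number of partitions of $n$. For a partition $\lambda=(\lambda_1\ge\lambda_2\ge\dots\ge\lambda_l>0)$, set $n(\lambda)=\sum_{i=1}^{l}(i-1)\lambda_i$. $N(n)=\sum_{\lambda\vdash n}n(\lambda)$, the sum over all partitions $\lambda$ of $n$. *)

theory Defs
  imports Complex_Main
begin

definition partitions :: "nat \<Rightarrow> nat list set" where
  "partitions n = {xs. sorted_wrt (\<ge>) xs \<and> (\<forall>x\<in>set xs. x > 0) \<and> sum_list xs = n}"

(* Without finiteness, the cardinality and the sum below would be 0 by convention. *)
lemma finite_partitions: "finite (partitions n)"
proof (rule finite_subset)
  show "partitions n \<subseteq> {xs. set xs \<subseteq> {..n} \<and> length xs \<le> n}"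
  proof
    fix xs assume "xs \<in> partitions n"
    then have pos: "\<forall>x\<in>set xs. x > 0" and n: "sum_list xs = n"
      by (auto simp: partitions_def)
    have "length ys \<le> sum_list ys" if "\<forall>x\<in>set ys. x > 0" for ys :: "nat list"
      using that by (induction ys) auto
    then have "length xs \<le> n" using pos n by blast
    moreover have "set xs \<subseteq> {..n}" using n member_le_sum_list by auto
    ultimately show "xs \<in> {xs. set xs \<subseteq> {..n} \<and> length xs \<le> n}" by simp
  qed
  show "finite {xs. set xs \<subseteq> {..n} \<and> length xs \<le> n}"
    by (rule finite_lists_length_le) simp
qed

definition num_partitions :: "nat \<Rightarrow> nat" where
  "num_partitions n = card (partitions n)"

(* List positions start at 0, so xs ! i is the part with index i + 1 in the usual
   numbering, and its weight (i + 1) - 1 is i. *)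
definition n_stat :: "nat list \<Rightarrow> nat" where
  "n_stat xs = (\<Sum>i<length xs. i * xs ! i)"

definition N_total :: "nat \<Rightarrow> nat" where
  "N_total n = (\<Sum>xs\<in>partitions n. n_stat xs)"

end

(* If a partition of n has k parts, Chebyshev's sum inequality gives n(lambda) <= n (k - 1) / 2, so it
   suffices that k is at most (n + 4) / 3 on average, i.e. that the sum of 4 + sum_i (lambda_i - 3) over
   all partitions of n is nonnegative.  The generating function of these sums is C(x) P(x), where
   P(x) = prod_i 1 / (1 - x^i), C has constant term 4 and its m-th coefficient is sum_{d | m} (d - 3).
   Although C itself has negative coefficients, C(x) / ((1 - x) ... (1 - x^7)) has none: they are
   nonnegative from some point on, and the initial ones are computed.  The remaining factors of P have
   nonnegative coefficients. *)
theory Submission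
  imports Defs "HOL-Library.Multiset" "HOL-Computational_Algebra.Formal_Power_Series"
begin

section \<open>The statistic n(lambda) and the number of parts\<close>

text \<open>In the induction, prepending \<open>x\<close> raises every old index by one, so
  \<open>n_stat\<close> grows by \<open>sum_list xs\<close>, which is at most
  \<open>length xs * x\<close> because \<open>x\<close> is a largest part.\<close>

lemma n_stat_le:
  assumes "sorted_wrt (\<ge>) xs"
  shows "2 * n_stat xs + sum_list xs \<le> length xs * sum_list xs"
  using assms
proof (induction xs)
  case Nil
  then show ?case by (simp add: n_stat_def)
next
  case (Cons x xs)
  have "sum_list xs \<le> (\<Sum>y\<leftarrow>xs. x)"
    using Cons.prems sum_list_mono[of xs "\<lambda>y. y" "\<lambda>_. x"] by simp
  then have le: "sum_list xs \<le> length xs * x"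
    by (simp add: sum_list_triv)
  have "n_stat (x # xs) = n_stat xs + sum_list xs"
    unfolding n_stat_def
    by (simp add: sum.lessThan_Suc_shift sum.distrib sum_list_sum_nth atLeast0LessThan del: sum.lessThan_Suc)
  then show ?case
    using Cons le by (simp add: algebra_simps)
qed

section \<open>Partitions with parts bounded below\<close>

text \<open>Multisets let a part be added or removed without any reordering. For r >= 1 the
  cardinalities have the generating function prod_{i >= r} 1 / (1 - x^i).\<close>

definition parts_ge :: "nat \<Rightarrow> nat \<Rightarrow> nat multiset set" where
  "parts_ge r n = {M. sum_mset M = n \<and> (\<forall>x\<in>#M. r \<le> x)}"

lemma bij_betw_mset_partitions: "bij_betw mset (partitions n) (parts_ge 1 n)"
proof (rule bij_betwI[where g = "\<lambda>M. rev (sorted_list_of_multiset M)"])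
  show "mset \<in> partitions n \<rightarrow> parts_ge 1 n"
    by (auto simp: partitions_def parts_ge_def sum_mset_sum_list Suc_le_eq)
  show "(\<lambda>M. rev (sorted_list_of_multiset M)) \<in> parts_ge 1 n \<rightarrow> partitions n"
    by (auto simp: partitions_def parts_ge_def sum_mset_sum_list[symmetric] Suc_le_eq
        sorted_wrt_rev sorted_sorted_list_of_multiset)
  show "rev (sorted_list_of_multiset (mset xs)) = xs" if "xs \<in> partitions n" for xs
  proof -
    have "sorted (rev xs)"
      using that by (simp add: partitions_def sorted_wrt_rev)
    then have "sort xs = rev xs"
      by (intro properties_for_sort) auto
    then show ?thesis by simp
  qed
  show "mset (rev (sorted_list_of_multiset M)) = M" for M :: "nat multiset"
    by simp
qed

lemma finite_parts_ge: "1 \<le> r \<Longrightarrow> finite (parts_ge r n)"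
proof (rule finite_subset)
  show "parts_ge r n \<subseteq> parts_ge 1 n" if "1 \<le> r"
    using that by (auto simp: parts_ge_def)
  show "finite (parts_ge 1 n)"
    using bij_betw_mset_partitions finite_partitions by (rule bij_betw_finite[THEN iffD1])
qed

lemma parts_ge_with_part:
  assumes "r \<le> j" "j \<le> n"
  shows "{M \<in> parts_ge r n. j \<in># M} = add_mset j ` parts_ge r (n - j)"
proof (intro equalityI subsetI)
  fix M assume M: "M \<in> {M \<in> parts_ge r n. j \<in># M}"
  then obtain M' where "M = add_mset j M'"
    by (auto dest: multi_member_split)
  with M show "M \<in> add_mset j ` parts_ge r (n - j)"
    by (auto simp: parts_ge_def)
qed (use assms in \<open>auto simp: parts_ge_def\<close>)

lemma part_le: "M \<in> parts_ge r n \<Longrightarrow> x \<in># M \<Longrightarrow> x \<le> n"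
  by (auto simp: parts_ge_def dest: multi_member_split)

definition num_ge :: "nat \<Rightarrow> nat \<Rightarrow> int" where
  "num_ge r n = int (card (parts_ge r n))"

text \<open>Either \<open>r\<close> is not a part, or one copy of it can be removed
  bijectively.\<close>

lemma num_ge_rec:
  assumes "1 \<le> r"
  shows "num_ge r n = num_ge (Suc r) n + (if r \<le> n then num_ge r (n - r) else 0)"
proof -
  have split: "parts_ge r n = parts_ge (Suc r) n \<union> {M \<in> parts_ge r n. r \<in># M}"
    by (auto simp: parts_ge_def Suc_le_eq order.strict_iff_order)
  have "num_ge r n = num_ge (Suc r) n + int (card {M \<in> parts_ge r n. r \<in># M})"
    unfolding num_ge_def
  proof (subst split, subst card_Un_disjoint)
    show "finite {M \<in> parts_ge r n. r \<in># M}"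
      using assms by (simp add: finite_parts_ge)
    show "parts_ge (Suc r) n \<inter> {M \<in> parts_ge r n. r \<in># M} = {}"
      by (auto simp: parts_ge_def)
  qed (simp_all add: finite_parts_ge)
  moreover have "int (card {M \<in> parts_ge r n. r \<in># M}) = (if r \<le> n then num_ge r (n - r) else 0)"
  proof (cases "r \<le> n")
    case True
    then show ?thesis
      by (simp add: parts_ge_with_part card_image inj_on_def num_ge_def)
  next
    case False
    then have none: "{M \<in> parts_ge r n. r \<in># M} = {}"
      using part_le by blast
    show ?thesis
      unfolding none using False by simp
  qed
  ultimately show ?thesis by simp
qed

section \<open>Additive statistics summed over all partitions\<close>

lemma sum_mset_count:
  fixes g :: "'a \<Rightarrow> int"
  assumes "finite A" "set_mset M \<subseteq> A"
  shows "(\<Sum>x\<in>#M. g x) = (\<Sum>j\<in>A. g j * int (count M j))"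
  using assms(2)
proof (induction M)
  case (add x M)
  have "(\<Sum>j\<in>A. g j * int (count (add_mset x M) j))
      = (\<Sum>j\<in>A. (if j = x then g j else 0) + g j * int (count M j))"
    by (rule sum.cong) (auto simp: algebra_simps)
  with add assms(1) show ?case
    by (simp add: sum.distrib)
qed simp

text \<open>Removing one copy of \<open>j\<close> leaves a partition of \<open>n - j\<close> with
  one \<open>j\<close> fewer. Iterating this visits n - j, n - 2j, ..., so the multiples
  \<open>m\<close> of \<open>j\<close> appear.\<close>

lemma sum_count_part:
  assumes "1 \<le> j"
  shows "(\<Sum>M\<in>parts_ge 1 n. int (count M j)) = (\<Sum>m | m \<in> {1..n} \<and> j dvd m. num_ge 1 (n - m))"
proof (induction n rule: less_induct)
  case (less n)
  have "(\<Sum>M\<in>parts_ge 1 n. int (count M j)) = (\<Sum>M\<in>{M \<in> parts_ge 1 n. j \<in># M}. int (count M j))"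
    by (rule sum.mono_neutral_right) (auto simp: finite_parts_ge not_in_iff)
  also have "\<dots> = (\<Sum>m | m \<in> {1..n} \<and> j dvd m. num_ge 1 (n - m))"
  proof (cases "j \<le> n")
    case True
    have multiples: "{m. m \<in> {1..n} \<and> j dvd m} = insert j ((+) j ` {m. m \<in> {1..n - j} \<and> j dvd m})"
    proof (intro equalityI subsetI)
      fix m assume m: "m \<in> {m. m \<in> {1..n} \<and> j dvd m}"
      then have "m = j \<or> (m = j + (m - j) \<and> m - j \<in> {1..n - j} \<and> j dvd (m - j))"
        by (auto dest: dvd_imp_le)
      then show "m \<in> insert j ((+) j ` {m. m \<in> {1..n - j} \<and> j dvd m})"
        by blast
    qed (use True assms in auto)
    have "(\<Sum>M\<in>{M \<in> parts_ge 1 n. j \<in># M}. int (count M j))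
        = (\<Sum>M\<in>parts_ge 1 (n - j). 1 + int (count M j))"
      using True assms by (simp only: parts_ge_with_part) (simp add: sum.reindex inj_on_def)
    also have "\<dots> = num_ge 1 (n - j) + (\<Sum>m | m \<in> {1..n - j} \<and> j dvd m. num_ge 1 (n - j - m))"
      using less[of "n - j"] True assms by (simp add: sum.distrib num_ge_def)
    also have "\<dots> = (\<Sum>m | m \<in> {1..n} \<and> j dvd m. num_ge 1 (n - m))"
      unfolding multiples by (subst sum.insert) (auto simp: sum.reindex)
    finally show ?thesis .
  next
    case False
    then have "{M \<in> parts_ge 1 n. j \<in># M} = {}" "{m. m \<in> {1..n} \<and> j dvd m} = {}"
      using part_le by (auto dest: dvd_imp_le)
    then show ?thesis by (metis sum.empty)
  qed
  finally show ?case .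
qed

text \<open>The sum is grouped by part size, and exchanging the two sums then collects the divisors
  of \<open>m\<close>. In series form, P(x) is multiplied by the Lambert series of
  \<open>g\<close>.\<close>

lemma sum_over_parts:
  fixes g :: "nat \<Rightarrow> int"
  shows "(\<Sum>M\<in>parts_ge 1 n. \<Sum>x\<in>#M. g x)
    = (\<Sum>m\<in>{1..n}. (\<Sum>d | d \<in> {1..m} \<and> d dvd m. g d) * num_ge 1 (n - m))"
proof -
  have "(\<Sum>M\<in>parts_ge 1 n. \<Sum>x\<in>#M. g x) = (\<Sum>M\<in>parts_ge 1 n. \<Sum>j\<in>{1..n}. g j * int (count M j))"
  proof (rule sum.cong[OF refl], rule sum_mset_count)
    fix M assume "M \<in> parts_ge 1 n"
    then show "set_mset M \<subseteq> {1..n}"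
      using part_le[of M 1 n] by (auto simp: parts_ge_def)
  qed simp
  also have "\<dots> = (\<Sum>j\<in>{1..n}. \<Sum>M\<in>parts_ge 1 n. g j * int (count M j))"
    by (rule sum.swap)
  also have "\<dots> = (\<Sum>j\<in>{1..n}. \<Sum>m | m \<in> {1..n} \<and> j dvd m. g j * num_ge 1 (n - m))"
  proof (rule sum.cong[OF refl])
    fix j assume "j \<in> {1..n}"
    then have count: "(\<Sum>M\<in>parts_ge 1 n. int (count M j)) = (\<Sum>m | m \<in> {1..n} \<and> j dvd m. num_ge 1 (n - m))"
      by (intro sum_count_part) simp
    show "(\<Sum>M\<in>parts_ge 1 n. g j * int (count M j)) = (\<Sum>m | m \<in> {1..n} \<and> j dvd m. g j * num_ge 1 (n - m))"
      unfolding sum_distrib_left[symmetric] count ..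
  qed
  also have "\<dots> = (\<Sum>m\<in>{1..n}. \<Sum>j | j \<in> {1..n} \<and> j dvd m. g j * num_ge 1 (n - m))"
    by (rule sum.swap_restrict) auto
  also have "\<dots> = (\<Sum>m\<in>{1..n}. (\<Sum>d | d \<in> {1..m} \<and> d dvd m. g d) * num_ge 1 (n - m))"
  proof (rule sum.cong[OF refl])
    fix m assume m: "m \<in> {1..n}"
    then have divisors: "{j. j \<in> {1..n} \<and> j dvd m} = {d. d \<in> {1..m} \<and> d dvd m}"
      by (auto dest: dvd_imp_le)
    show "(\<Sum>j | j \<in> {1..n} \<and> j dvd m. g j * num_ge 1 (n - m))
        = (\<Sum>d | d \<in> {1..m} \<and> d dvd m. g d) * num_ge 1 (n - m)"
      unfolding divisors by (rule sum_distrib_right[symmetric])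
  qed
  finally show ?thesis .
qed

section \<open>Division of power series by 1 - x^r\<close>

text \<open>The coefficients of the power series \<open>f(x) / (1 - x\<^sup>r)\<close>, for \<open>r > 0\<close>.\<close>

fun divide_coeffs :: "nat \<Rightarrow> (nat \<Rightarrow> int) \<Rightarrow> nat \<Rightarrow> int" where
  "divide_coeffs r f n = f n + (if 0 < r \<and> r \<le> n then divide_coeffs r f (n - r) else 0)"

declare divide_coeffs.simps [simp del]

lemma fps_divide_coeffs:
  assumes "1 \<le> r"
  shows "Abs_fps (divide_coeffs r f) * (1 - fps_X ^ r) = Abs_fps f"
proof (rule fps_ext)
  fix n
  show "fps_nth (Abs_fps (divide_coeffs r f) * (1 - fps_X ^ r)) n = fps_nth (Abs_fps f) n"
    using assms
    by (simp add: algebra_simps fps_X_power_mult_nth fps_X_power_mult_right_nth divide_coeffs.simps[of r f n])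
qed

lemma fps_num_ge:
  assumes "1 \<le> r"
  shows "Abs_fps (num_ge r) * (1 - fps_X ^ r) = Abs_fps (num_ge (Suc r))"
proof (rule fps_ext)
  fix n
  show "fps_nth (Abs_fps (num_ge r) * (1 - fps_X ^ r)) n = fps_nth (Abs_fps (num_ge (Suc r))) n"
    using assms num_ge_rec[OF assms, of n]
    by (simp add: algebra_simps fps_X_power_mult_nth fps_X_power_mult_right_nth)
qed

text \<open>Moves the factor 1 / (1 - x^r) from the partition series to the series of
  \<open>f\<close>.\<close>

lemma divide_coeffs_mult_num_ge:
  assumes "1 \<le> r"
  shows "Abs_fps f * Abs_fps (num_ge r) = Abs_fps (divide_coeffs r f) * Abs_fps (num_ge (Suc r))"
  by (subst fps_divide_coeffs[OF assms, of f, symmetric], subst fps_num_ge[OF assms, symmetric])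
     (simp add: mult_ac)

text \<open>The recursion adds \<open>f n\<close> to the quotient coefficient \<open>r\<close>
  places earlier. So \<open>r\<close> consecutive nonnegative values from \<open>b\<close> on
  propagate, and only values \<open>f n\<close> with n >= b + r enter.\<close>

lemma divide_coeffs_nonneg:
  assumes f: "\<And>n. a \<le> n \<Longrightarrow> 0 \<le> f n" and "a \<le> b + r" "0 < r"
    and base: "\<forall>n\<in>set [b..<b + r]. 0 \<le> divide_coeffs r f n"
    and "b \<le> n"
  shows "0 \<le> divide_coeffs r f n"
  using \<open>b \<le> n\<close>
proof (induction n rule: less_induct)
  case (less n)
  show ?case
  proof (cases "n < b + r")
    case True
    then show ?thesis using base less.prems by simp
  next
    case False
    then have "0 \<le> divide_coeffs r f (n - r)" "0 \<le> f n"
      using less \<open>0 < r\<close> \<open>a \<le> b + r\<close> by (auto intro!: f)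
    then show ?thesis
      by (simp add: divide_coeffs.simps[of r f n])
  qed
qed

section \<open>The series C and its quotients\<close>

text \<open>The coefficients of C. The divisors are enumerated as a list to make initial values
  computable.\<close>

definition excess :: "nat \<Rightarrow> int" where
  "excess m = (if m = 0 then 4 else \<Sum>d\<leftarrow>filter (\<lambda>d. d dvd m) [1..<Suc m]. int d - 3)"

lemma excess_eq: "0 < m \<Longrightarrow> excess m = (\<Sum>d | d \<in> {1..m} \<and> d dvd m. int d - 3)"
  unfolding excess_def
  by (simp add: sum_list_distinct_conv_sum_set del: upt_Suc)
     (rule sum.cong, auto)

text \<open>Only the divisors 1 and 2 contribute negatively, and the divisor \<open>m\<close> outweighs both.\<close>

lemma excess_nonneg:
  assumes "5 \<le> m"
  shows "0 \<le> excess m"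
proof -
  let ?D = "{d. d \<in> {1..m} \<and> d dvd m}"
  \<comment> \<open>The remaining divisors are at least 3, so 0 bounds their terms from below. For
    even \<open>m\<close> the total is m - 6, where m >= 6; for odd \<open>m\<close> it is m -
    5.\<close>
  have "0 \<le> (\<Sum>d\<in>?D. (if d = 1 then -2 else 0) + (if d = 2 then -1 else 0)
      + (if d = m then int m - 3 else 0))"
    using assms by (auto simp: sum.distrib) presburger+
  also have "\<dots> \<le> (\<Sum>d\<in>?D. int d - 3)"
    using assms by (intro sum_mono) auto
  finally show ?thesis
    using assms by (simp add: excess_eq)
qed

text \<open>The coefficients of C(x) / ((1 - x) ... (1 - x^r)).\<close>

primrec excess_quot :: "nat \<Rightarrow> nat \<Rightarrow> int" where
  "excess_quot 0 = excess"
| "excess_quot (Suc r) = divide_coeffs (Suc r) (excess_quot r)"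

declare excess_quot.simps [simp del]

lemma excess_quot_mult_num_ge:
  "Abs_fps excess * Abs_fps (num_ge 1) = Abs_fps (excess_quot r) * Abs_fps (num_ge (Suc r))"
proof (induction r)
  case (Suc r)
  also have "Abs_fps (excess_quot r) * Abs_fps (num_ge (Suc r))
      = Abs_fps (excess_quot (Suc r)) * Abs_fps (num_ge (Suc (Suc r)))"
    unfolding excess_quot.simps by (rule divide_coeffs_mult_num_ge) simp
  finally show ?case .
qed (simp add: excess_quot.simps)

lemma excess_quot_rec: "0 < r \<Longrightarrow> excess_quot r n = excess_quot (r - 1) n + (if r \<le> n then excess_quot r (n - r) else 0)"
  using divide_coeffs.simps[of r "excess_quot (r - 1)" n] by (cases r) (simp_all add: excess_quot.simps)

section \<open>Initial coefficients of the quotients\<close>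

text \<open>Only here are divisor sums evaluated; each later table follows from the preceding one by
  the recursion. Index 18 ends the last window needed, 12 to 18 for the factor 1 - x^7.\<close>

lemma excess_quot_0_table:
  "map (excess_quot 0) [0, 1, 2, 3, 4, 5, 6, 7, 8, 9, 10, 11, 12, 13, 14, 15, 16, 17, 18]
    = [4, -2, -3, -2, -2, 0, 0, 2, 3, 4, 6, 6, 10, 8, 12, 12, 16, 12, 21]"
  by code_simp

lemma excess_quot_1_table:
  "map (excess_quot 1) [0, 1, 2, 3, 4, 5, 6, 7, 8, 9, 10, 11, 12, 13, 14, 15, 16, 17, 18]
    = [4, 2, -1, -3, -5, -5, -5, -3, 0, 4, 10, 16, 26, 34, 46, 58, 74, 86, 107]"
  using excess_quot_0_table by (simp add: excess_quot_rec[of "Suc 0"])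

lemma excess_quot_2_table:
  "map (excess_quot 2) [0, 1, 2, 3, 4, 5, 6, 7, 8, 9, 10, 11, 12, 13, 14, 15, 16, 17, 18]
    = [4, 2, 3, -1, -2, -6, -7, -9, -7, -5, 3, 11, 29, 45, 75, 103, 149, 189, 256]"
  using excess_quot_1_table by (simp add: excess_quot_rec[of 2])

lemma excess_quot_3_table:
  "map (excess_quot 3) [0, 1, 2, 3, 4, 5, 6, 7, 8, 9, 10, 11, 12, 13, 14, 15, 16, 17, 18]
    = [4, 2, 3, 3, 0, -3, -4, -9, -10, -9, -6, 1, 20, 39, 76, 123, 188, 265, 379]"
  using excess_quot_2_table by (simp add: excess_quot_rec[of 3])

lemma excess_quot_4_table:
  "map (excess_quot 4) [0, 1, 2, 3, 4, 5, 6, 7, 8, 9, 10, 11, 12, 13, 14, 15, 16, 17, 18]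
    = [4, 2, 3, 3, 4, -1, -1, -6, -6, -10, -7, -5, 14, 29, 69, 118, 202, 294, 448]"
  using excess_quot_3_table by (simp add: excess_quot_rec[of 4])

lemma excess_quot_5_table:
  "map (excess_quot 5) [0, 1, 2, 3, 4, 5, 6, 7, 8, 9, 10, 11, 12, 13, 14, 15, 16, 17, 18]
    = [4, 2, 3, 3, 4, 3, 1, -3, -3, -6, -4, -4, 11, 26, 63, 114, 198, 305, 474]"
  using excess_quot_4_table by (simp add: excess_quot_rec[of 5])

lemma excess_quot_6_table:
  "map (excess_quot 6) [0, 1, 2, 3, 4, 5, 6, 7, 8, 9, 10, 11, 12, 13, 14, 15, 16, 17, 18]
    = [4, 2, 3, 3, 4, 3, 5, -1, 0, -3, 0, -1, 16, 25, 63, 111, 198, 304, 490]"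
  using excess_quot_5_table by (simp add: excess_quot_rec[of 6])

lemma excess_quot_7_table:
  "map (excess_quot 7) [0, 1, 2, 3, 4, 5, 6, 7, 8, 9, 10, 11, 12, 13, 14, 15, 16, 17, 18]
    = [4, 2, 3, 3, 4, 3, 5, 3, 2, 0, 3, 3, 19, 30, 66, 113, 198, 307, 493]"
  using excess_quot_6_table by (simp add: excess_quot_rec[of 7])

section \<open>Nonnegativity of the seventh quotient and of the sum of excesses\<close>

lemma excess_quot_nonneg_step:
  assumes "\<And>n. a \<le> n \<Longrightarrow> 0 \<le> excess_quot (r - 1) n" "a \<le> b + r" "0 < r"
    and "\<forall>n\<in>set [b..<b + r]. 0 \<le> excess_quot r n"
    and "b \<le> n"
  shows "0 \<le> excess_quot r n"
  using divide_coeffs_nonneg[of a "excess_quot (r - 1)" b r n] assms by (cases r) (auto simp: excess_quot.simps)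

text \<open>Seven is the first number of factors for which no negative coefficient is left.\<close>

lemma excess_quot_7_nonneg: "0 \<le> excess_quot 7 n"
proof -
  \<comment> \<open>Each threshold in \<open>nonneg0\<close> to \<open>nonneg6\<close> comes right
    after the last negative entry of its table. From \<open>nonneg1\<close> on, the \<open>r\<close>
    table entries starting there begin the propagation.\<close>
  have nonneg0: "0 \<le> excess_quot 0 n" if "5 \<le> n" for n
    using that by (simp add: excess_quot.simps excess_nonneg)
  have nonneg1: "0 \<le> excess_quot 1 n" if "8 \<le> n" for n
    by (rule excess_quot_nonneg_step[of 5 1 8]) (use nonneg0 that excess_quot_1_table in simp_all)
  have nonneg2: "0 \<le> excess_quot 2 n" if "10 \<le> n" for n
    by (rule excess_quot_nonneg_step[of 8 2 10]) (use nonneg1 that excess_quot_2_table in simp_all)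
  have nonneg3: "0 \<le> excess_quot 3 n" if "11 \<le> n" for n
    by (rule excess_quot_nonneg_step[of 10 3 11]) (use nonneg2 that excess_quot_3_table in simp_all)
  have nonneg4: "0 \<le> excess_quot 4 n" if "12 \<le> n" for n
    by (rule excess_quot_nonneg_step[of 11 4 12]) (use nonneg3 that excess_quot_4_table in simp_all)
  have nonneg5: "0 \<le> excess_quot 5 n" if "12 \<le> n" for n
    by (rule excess_quot_nonneg_step[of 12 5 12]) (use nonneg4 that excess_quot_5_table in simp_all)
  have nonneg6: "0 \<le> excess_quot 6 n" if "12 \<le> n" for n
    by (rule excess_quot_nonneg_step[of 12 6 12]) (use nonneg5 that excess_quot_6_table in simp_all)
  show ?thesis
  proof (cases "12 \<le> n")
    case True
    show ?thesis
      by (rule excess_quot_nonneg_step[of 12 7 12]) (use nonneg6 True excess_quot_7_table in simp_all)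
  next
    case False
    then have "n = 0 \<or> n = 1 \<or> n = 2 \<or> n = 3 \<or> n = 4 \<or> n = 5
        \<or> n = 6 \<or> n = 7 \<or> n = 8 \<or> n = 9 \<or> n = 10 \<or> n = 11"
      by presburger
    then show ?thesis using excess_quot_7_table by auto
  qed
qed

text \<open>Moving seven factors of P to C leaves a product of two series with nonnegative
  coefficients.\<close>

lemma excess_sum_nonneg: "0 \<le> (\<Sum>m\<in>{0..n}. excess m * num_ge 1 (n - m))"
proof -
  have "(\<Sum>m\<in>{0..n}. excess m * num_ge 1 (n - m))
      = fps_nth (Abs_fps excess * Abs_fps (num_ge 1)) n"
    by (simp add: fps_mult_nth)
  also have "\<dots> = (\<Sum>m\<in>{0..n}. excess_quot 7 m * num_ge 8 (n - m))"
    unfolding excess_quot_mult_num_ge[of 7] by (simp add: fps_mult_nth)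
  also have "\<dots> \<ge> 0"
    by (intro sum_nonneg mult_nonneg_nonneg excess_quot_7_nonneg) (simp add: num_ge_def)
  finally show ?thesis .
qed

section \<open>The average number of parts and the final estimate\<close>

lemma sum_length_partitions:
  "3 * (\<Sum>xs\<in>partitions n. length xs) \<le> (n + 4) * num_partitions n"
proof -
  have card: "int (num_partitions n) = num_ge 1 n"
    using bij_betw_same_card[OF bij_betw_mset_partitions] by (simp add: num_partitions_def num_ge_def)
  \<comment> \<open>The term for m = 0 is set apart: it counts 4 for each partition and is no
    divisor sum, while the other terms have the form in \<open>sum_over_parts\<close>.\<close>
  have "0 \<le> excess 0 * num_ge 1 n + (\<Sum>m\<in>{1..n}. excess m * num_ge 1 (n - m))"
    using excess_sum_nonneg[of n] by (simp add: sum.atLeast_Suc_atMost)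
  also have "(\<Sum>m\<in>{1..n}. excess m * num_ge 1 (n - m)) = (\<Sum>M\<in>parts_ge 1 n. \<Sum>x\<in>#M. int x - 3)"
    unfolding sum_over_parts by (intro sum.cong refl) (simp add: excess_eq)
  also have "\<dots> = (\<Sum>xs\<in>partitions n. \<Sum>x\<in>#mset xs. int x - 3)"
    by (rule sum.reindex_bij_betw[OF bij_betw_mset_partitions, symmetric])
  also have "\<dots> = (\<Sum>xs\<in>partitions n. int n - 3 * int (length xs))"
  proof (rule sum.cong[OF refl])
    fix xs :: "nat list" assume "xs \<in> partitions n"
    moreover have "(\<Sum>x\<in>#mset xs. int x - 3) = int (sum_list xs) - 3 * int (length xs)"
      by (induction xs) auto
    ultimately show "(\<Sum>x\<in>#mset xs. int x - 3) = int n - 3 * int (length xs)"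
      by (simp add: partitions_def)
  qed
  also have "\<dots> = int n * int (num_partitions n) - 3 * int (\<Sum>xs\<in>partitions n. length xs)"
    by (simp add: sum_subtractf sum_distrib_left num_partitions_def)
  finally have "int (3 * (\<Sum>xs\<in>partitions n. length xs)) \<le> int ((n + 4) * num_partitions n)"
    by (simp add: card[symmetric, unfolded One_nat_def] excess_def algebra_simps)
  then show ?thesis
    by (simp only: of_nat_le_iff)
qed

theorem theorem3p6:
  fixes n :: nat
  assumes "n \<ge> 1"
  shows "real (N_total n) \<le> 1 / 6 * real n * (real n + 1) * real (num_partitions n)"
proof -
  have "(\<Sum>xs\<in>partitions n. 2 * n_stat xs + n) \<le> (\<Sum>xs\<in>partitions n. length xs * n)"
  proof (rule sum_mono)
    fix xs assume "xs \<in> partitions n"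
    then show "2 * n_stat xs + n \<le> length xs * n"
      using n_stat_le[of xs] by (simp add: partitions_def)
  qed
  then have "2 * N_total n + n * num_partitions n \<le> n * (\<Sum>xs\<in>partitions n. length xs)"
    by (simp add: N_total_def num_partitions_def sum.distrib sum_distrib_left sum_distrib_right mult.commute)
  \<comment> \<open>The factor 3 fits the bound (n + 4) / 3 on the average number of parts. Since (n
    + 4) - 3 = n + 1, the result is 6 N(n) <= n (n + 1) p(n).\<close>
  then have "3 * (2 * N_total n + n * num_partitions n) \<le> n * (3 * (\<Sum>xs\<in>partitions n. length xs))"
    by simp
  also have "\<dots> \<le> n * ((n + 4) * num_partitions n)"
    using sum_length_partitions by (rule mult_le_mono2)
  finally have "real (3 * (2 * N_total n + n * num_partitions n)) \<le> real (n * ((n + 4) * num_partitions n))"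
    by (simp only: of_nat_le_iff)
  then show ?thesis
    by (simp add: algebra_simps)
qed

end
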